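(* Let $d \ge 1$ and let $\phi: \mathbb{R}^d \to\mathbb{R}$ be a convex and Lipschitz continuous function. Then for any $\eta > 0$, $R > 0$ and $q>1$, $$\int_{B(0, R)} \mathrm{diam}(\partial \phi(B(x, \eta)))^q \, dx \leq c_{d, q, R, \eta}\, \mathrm{Lip}(\phi)^q\, \eta,$$ with $c_{d, q, R, \eta} = 48\, d^2 \beta_d\, 2^{3d + q-1}\, \frac{q}{q-1}\,(R+4\eta)^{d-1}$, where $\beta_d$ denotes the volume of the unit ball of $\mathbb{R}^d$.
   Context: $B(x,r)$ is the open Euclidean ball of center $x$ and radius $r$ in $\mathbb{R}^d$. $\mathrm{Lip}(\phi)$ is the Lipschitz constant of $\phi$ with respect to the Euclidean norm. For $x \in \mathbb{R}^d$, $\partial\phi(x) = \{ g \in \mathbb{R}^d \mid \phi(y) \ge \phi(x) + \langle g | y - x\rangle \ \forall y \in \mathbb{R}^d\}$ is the subdifferential of $\phi$ at $x$, and for a set $A \subset \mathbb{R}^d$, $\partial \phi(A) = \bigcup_{x \in A} \partial\phi(x)$. $\mathrm{diam}$ denotes the Euclidean diameter of a set. *)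

theory Defs
  imports "HOL-Analysis.Analysis"
begin

definition subdifferential :: "('a::real_inner \<Rightarrow> real) \<Rightarrow> 'a \<Rightarrow> 'a set" where
  "subdifferential \<phi> x = {g. \<forall>y. \<phi> y \<ge> \<phi> x + g \<bullet> (y - x)}"

definition subdifferential_on :: "('a::real_inner \<Rightarrow> real) \<Rightarrow> 'a set \<Rightarrow> 'a set" where
  "subdifferential_on \<phi> A = (\<Union>x\<in>A. subdifferential \<phi> x)"

(* The smallest admissible constant. The predicate lipschitz_on includes 0 \<le> L, so the set is
   bounded below; it is nonempty exactly when f is Lipschitz, and Lip f means nothing otherwise. *)
definition Lip :: "('a::metric_space \<Rightarrow> 'b::metric_space) \<Rightarrow> real" where
  "Lip f = Inf {L. L-lipschitz_on UNIV f}"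

end

theory Submission
  imports Defs
begin

text \<open>
  A large oscillation of the subgradients of \<open>\<phi>\<close> near \<open>x\<close> forces large second differences
  \<open>D m h = \<phi> (m + h) + \<phi> (m - h) - 2 * \<phi> m\<close> near \<open>x\<close>, whereas the integral of second differences
  over a ball of radius \<open>R\<close> is only of surface order \<open>R ^ (d - 1)\<close>. The second differences play
  the part that the distributional Hessian of \<open>\<phi>\<close> would play; they are nonnegative by convexity
  and blind to affine functions.

  Lower bound. Let \<open>g1\<close>, \<open>g2\<close> be subgradients at points \<open>x1\<close>, \<open>x2\<close> of the ball of radius \<open>\<eta>\<close>
  about \<open>x\<close>, and subtract from \<open>\<phi>\<close> its affine minorant of slope \<open>g1\<close> at \<open>x1\<close>. The remainder \<open>\<psi>\<close>
  is convex and nonnegative, vanishes at \<open>x1\<close>, and lies above an affine function of slope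
  \<open>g2 - g1\<close>; hence it is at least \<open>\<eta> * norm (g2 - g1)\<close> at the point \<open>3\<eta>\<close> away from \<open>x1\<close> in the
  direction of \<open>g2 - g1\<close>, and its integral over the ball of radius \<open>4\<eta>\<close> about \<open>x1\<close> is at least
  \<open>\<eta> * norm (g2 - g1)\<close> times the volume \<open>V\<close> of a ball of radius \<open>\<eta>\<close>
  (\<open>subgradient_gap_le_set_integral\<close>). On the other hand \<open>\<psi>\<close> grows at least linearly along rays
  from \<open>x1\<close>, so its mean over the ball of radius \<open>\<eta>\<close> is at most a quarter of its mean over the
  ball of radius \<open>4\<eta>\<close>. Jensen's inequality turns this discrepancy into a lower bound for the
  integral of \<open>D m h\<close> over \<open>m\<close> in the ball of radius \<open>\<eta>\<close> about \<open>x1\<close> and \<open>h\<close> in the ball of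
  radius \<open>4\<eta>\<close> about \<open>0\<close> (\<open>set_integral_second_difference_ge\<close>). As \<open>D\<close> is nonnegative, \<open>m\<close> may
  range over the ball of radius \<open>2\<eta>\<close> about \<open>x\<close> instead, which no longer depends on \<open>x1\<close>. So the
  integral \<open>Q x\<close> of \<open>D\<close> over these \<open>m\<close> and \<open>h\<close> satisfies
  \<open>3 / 2 * \<eta> * V\<^sup>2 * norm (g2 - g1) \<le> Q x\<close>, and \<open>norm (g2 - g1)\<close> may be replaced by the diameter.

  Upper bound. Write \<open>D m h = F (m + h) - F m\<close> with \<open>F m = \<phi> m - \<phi> (m - h)\<close>, which is bounded by
  \<open>L * norm h\<close>. Shifting a ball of radius \<open>R\<close> by \<open>h\<close> changes the integral of \<open>F\<close> by at most
  twice this bound times the volume of a thin shell, so the integral of \<open>D\<close> over \<open>m\<close> is at most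
  \<open>2 * L * (norm h)\<^sup>2 * d * \<beta> * (R + norm h) ^ (d - 1)\<close> (\<open>set_integral_second_difference_le\<close>).

  Integrating \<open>Q\<close> over the ball of radius \<open>R\<close> with the order of integration exchanged bounds the
  first power of the diameter in the mean, with the constant
  \<open>64 / 3 * 8 ^ d * d * \<beta> * (R + 4 * \<eta>) ^ (d - 1)\<close>; the factor \<open>8 ^ d = 4 ^ d * 2 ^ d\<close> comes from
  the radii \<open>4\<eta>\<close> and \<open>2\<eta>\<close>. Subgradients have norm at most \<open>L\<close>, so the \<open>q\<close>-th power of the diameter
  is at most \<open>(2 * L) powr (q - 1)\<close> times the diameter, and \<open>64 / 3 * d \<le> 48 * d\<^sup>2 * (q / (q - 1))\<close>.
\<close>

section \<open>Integrals of continuous functions over balls\<close>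

lemma set_integral_cball_affine:
  fixes f :: "'a::euclidean_space \<Rightarrow> real"
  assumes k: "k \<noteq> 0" and f: "f \<in> borel_measurable borel"
  shows "(LINT y:cball c (\<bar>k\<bar> * r)|lborel. f y)
       = \<bar>k\<bar> ^ DIM('a) * (LINT u:cball b r|lborel. f (c + k *\<^sub>R (u - b)))"
proof -
  have [measurable]: "f \<in> borel_measurable borel" "cball c s \<in> sets borel" for s
    using f by auto
  let ?T = "\<lambda>x. (c - k *\<^sub>R b) + k *\<^sub>R x"
  have "(LINT y:cball c (\<bar>k\<bar> * r)|lborel. f y)
      = (\<integral>y. indicator (cball c (\<bar>k\<bar> * r)) y * f y
           \<partial>density (distr lborel borel ?T) (\<lambda>_. \<bar>k\<bar> ^ DIM('a)))"
    unfolding set_lebesgue_integral_def real_scaleR_def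
    by (subst lborel_affine[OF k, of "c - k *\<^sub>R b"]) simp
  also have "\<dots> = (\<integral>y. \<bar>k\<bar> ^ DIM('a) * (indicator (cball c (\<bar>k\<bar> * r)) y * f y)
           \<partial>distr lborel borel ?T)"
    by (subst integral_density) auto
  also have "\<dots> = (\<integral>u. \<bar>k\<bar> ^ DIM('a) * (indicator (cball c (\<bar>k\<bar> * r)) (?T u) * f (?T u)) \<partial>lborel)"
    by (subst integral_distr) auto
  also have "\<dots> = (\<integral>u. \<bar>k\<bar> ^ DIM('a) * (indicator (cball b r) u * f (c + k *\<^sub>R (u - b))) \<partial>lborel)"
  proof (rule Bochner_Integration.integral_cong[OF refl])
    fix u
    have T: "?T u = c + k *\<^sub>R (u - b)" by (simp add: algebra_simps)
    have "dist c (?T u) = \<bar>k\<bar> * dist b u"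
      unfolding T by (simp add: dist_norm norm_minus_commute)
    then have "?T u \<in> cball c (\<bar>k\<bar> * r) \<longleftrightarrow> u \<in> cball b r"
      using k by (simp add: mem_cball)
    then show "\<bar>k\<bar> ^ DIM('a) * (indicator (cball c (\<bar>k\<bar> * r)) (?T u) * f (?T u))
             = \<bar>k\<bar> ^ DIM('a) * (indicator (cball b r) u * f (c + k *\<^sub>R (u - b)))"
      unfolding T by (simp add: indicator_def)
  qed
  finally show ?thesis by (simp add: set_lebesgue_integral_def)
qed

lemma set_integrable_compact:
  fixes f :: "'a::euclidean_space \<Rightarrow> real"
  assumes "compact S" "continuous_on UNIV f"
  shows "set_integrable lborel S f"
  unfolding set_integrable_def
  using assms by (intro borel_integrable_compact) (auto intro: continuous_on_subset)

text \<open>Fubini's theorem, together with the integrability of the inner integral; on compact sets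
  continuity of the integrand supplies the integrability over the product.\<close>
lemma
  fixes f :: "'a::euclidean_space \<Rightarrow> 'b::euclidean_space \<Rightarrow> real"
  assumes S: "compact S" and T: "compact T" and f: "continuous_on UNIV (\<lambda>(x, y). f x y)"
  shows set_integrable_section_integral: "set_integrable lborel S (\<lambda>x. LINT y:T|lborel. f x y)"
    and set_integral_product: "(LINT p:S \<times> T|lborel. f (fst p) (snd p))
          = (LINT x:S|lborel. LINT y:T|lborel. f x y)"
    and set_integral_swap: "(LINT x:S|lborel. LINT y:T|lborel. f x y)
          = (LINT y:T|lborel. LINT x:S|lborel. f x y)"
proof -
  interpret lborel_pair: pair_sigma_finite "lborel :: 'a measure" "lborel :: 'b measure" ..
  let ?g = "\<lambda>p. indicator (S \<times> T) p *\<^sub>R (case p of (x, y) \<Rightarrow> f x y)"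
  have "integrable lborel ?g"
    using set_integrable_compact[OF compact_Times[OF S T] f] by (simp add: set_integrable_def)
  then have g: "integrable (lborel \<Otimes>\<^sub>M lborel) ?g"
    by (simp add: lborel_prod)
  show "set_integrable lborel S (\<lambda>x. LINT y:T|lborel. f x y)"
    using lborel_pair.integrable_fst'[OF g]
    by (simp add: indicator_times mult.assoc set_integrable_def set_lebesgue_integral_def)
  have "(LINT p:S \<times> T|lborel. f (fst p) (snd p)) = integral\<^sup>L (lborel \<Otimes>\<^sub>M lborel) ?g"
    by (simp add: lborel_prod set_lebesgue_integral_def case_prod_beta)
  also have "\<dots> = (LINT x|lborel. LINT y|lborel. ?g (x, y))"
    using lborel_pair.integral_fst'[OF g] by simp
  also have "\<dots> = (LINT x:S|lborel. LINT y:T|lborel. f x y)"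
    by (simp add: indicator_times mult.assoc set_lebesgue_integral_def)
  finally show "(LINT p:S \<times> T|lborel. f (fst p) (snd p))
    = (LINT x:S|lborel. LINT y:T|lborel. f x y)" .
  have "(LINT y|lborel. LINT x|lborel. ?g (x, y)) = (LINT x|lborel. LINT y|lborel. ?g (x, y))"
    using lborel_pair.Fubini_integral[of "\<lambda>x y. ?g (x, y)"] g by (simp add: case_prod_unfold)
  moreover have "(LINT y|lborel. LINT x|lborel. ?g (x, y)) = (LINT y:T|lborel. LINT x:S|lborel. f x y)"
    by (simp add: indicator_times mult.assoc mult.left_commute[of "indicator S _"]
        set_lebesgue_integral_def)
  moreover have "(LINT x|lborel. LINT y|lborel. ?g (x, y)) = (LINT x:S|lborel. LINT y:T|lborel. f x y)"
    by (simp add: indicator_times mult.assoc set_lebesgue_integral_def)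
  ultimately show "(LINT x:S|lborel. LINT y:T|lborel. f x y) = (LINT y:T|lborel. LINT x:S|lborel. f x y)"
    by simp
qed

lemma set_integral_mono_domain:
  fixes f :: "'a \<Rightarrow> real"
  assumes "set_integrable M B f" "A \<in> sets M" "A \<subseteq> B" "\<And>x. x \<in> B \<Longrightarrow> 0 \<le> f x"
  shows "(LINT x:A|M. f x) \<le> (LINT x:B|M. f x)"
proof -
  have "set_integrable M A f" using assms set_integrable_subset by blast
  then show ?thesis
    using assms unfolding set_integrable_def set_lebesgue_integral_def
    by (auto intro!: integral_mono simp: indicator_def)
qed

lemma measure_cball_eq:
  fixes c :: "'a::euclidean_space"
  assumes "r \<ge> 0"
  shows "measure lborel (cball c r) = measure lborel (ball (0::'a) 1) * r ^ DIM('a)"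
  using assms by (simp add: content_cball content_ball)

lemma set_integral_cball_const:
  fixes c :: "'a::euclidean_space" and K :: real
  shows "(LINT x:cball c r|lborel. K) = measure lborel (cball c r) * K"
  using emeasure_bounded_finite[OF bounded_cball[of c r]] by (subst set_integral_const) auto

lemma set_integral_cball_reflect:
  fixes f :: "'a::euclidean_space \<Rightarrow> real"
  assumes "continuous_on UNIV f"
  shows "(LINT y:cball c r|lborel. f (2 *\<^sub>R c - y)) = (LINT y:cball c r|lborel. f y)"
  using set_integral_cball_affine[of "-1" f c r c] assms
  by (simp add: borel_measurable_continuous_onI algebra_simps scaleR_2)

section \<open>Means of convex functions over balls\<close>

text \<open>Jensen's inequality for a ball. Averaging over the reflection \<open>y \<mapsto> 2 * c - y\<close>, which
  preserves the ball, reduces it to convexity at the midpoint \<open>c\<close> of \<open>y\<close> and its image.\<close>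
lemma convex_le_set_integral_cball:
  fixes f :: "'a::euclidean_space \<Rightarrow> real"
  assumes cvx: "convex_on UNIV f" and cont: "continuous_on UNIV f"
  shows "measure lborel (cball c r) * f c \<le> (LINT y:cball c r|lborel. f y)"
proof -
  have cont': "continuous_on UNIV (\<lambda>y. f (2 *\<^sub>R c - y))"
    by (intro continuous_on_compose2[OF cont] continuous_intros) auto
  have int: "set_integrable lborel (cball c r) f" "set_integrable lborel (cball c r) (\<lambda>y. f (2 *\<^sub>R c - y))"
    using cont cont' by (auto intro: set_integrable_compact)
  have "measure lborel (cball c r) * (2 * f c) = (LINT y:cball c r|lborel. 2 * f c)"
    by (simp only: set_integral_cball_const)
  also have "\<dots> \<le> (LINT y:cball c r|lborel. f y + f (2 *\<^sub>R c - y))"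
  proof (rule set_integral_mono)
    show "set_integrable lborel (cball c r) (\<lambda>_. 2 * f c)"
      by (intro set_integrable_compact) auto
    show "set_integrable lborel (cball c r) (\<lambda>y. f y + f (2 *\<^sub>R c - y))"
      using int by (rule set_integral_add)
    fix y
    have "c = (1/2) *\<^sub>R y + (1/2) *\<^sub>R (2 *\<^sub>R c - y)" by (simp add: algebra_simps)
    then have "f c \<le> (1/2) * f y + (1/2) * f (2 *\<^sub>R c - y)"
      using convex_onD[OF cvx, of "1/2" y "2 *\<^sub>R c - y"] by simp
    then show "2 * f c \<le> f y + f (2 *\<^sub>R c - y)" by simp
  qed
  also have "\<dots> = 2 * (LINT y:cball c r|lborel. f y)"
    using int by (simp add: set_integral_cball_reflect[OF cont])
  finally show ?thesis by simp
qed

text \<open>If \<open>f c = 0\<close>, convexity gives \<open>f (c + t * (u - c)) \<le> t * f u\<close>. Scaling the ball about \<open>c\<close>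
  thus gains, besides the volume factor, one further factor \<open>t\<close>; this gain is what bounds the
  second differences from below.\<close>
lemma set_integral_cball_homothety_le:
  fixes f :: "'a::euclidean_space \<Rightarrow> real"
  assumes cvx: "convex_on UNIV f" and cont: "continuous_on UNIV f" and zero: "f c = 0"
    and t: "0 < t" "t \<le> 1"
  shows "(LINT y:cball c (t * r)|lborel. f y) \<le> t ^ DIM('a) * (t * (LINT y:cball c r|lborel. f y))"
proof -
  have "(LINT y:cball c (t * r)|lborel. f y)
      = t ^ DIM('a) * (LINT u:cball c r|lborel. f (c + t *\<^sub>R (u - c)))"
    using set_integral_cball_affine[of t f c r c] t cont
    by (simp add: borel_measurable_continuous_onI)
  also have "(LINT u:cball c r|lborel. f (c + t *\<^sub>R (u - c))) \<le> (LINT u:cball c r|lborel. t * f u)"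
  proof (rule set_integral_mono)
    show "set_integrable lborel (cball c r) (\<lambda>u. f (c + t *\<^sub>R (u - c)))"
      by (intro set_integrable_compact continuous_on_compose2[OF cont] continuous_intros) auto
    show "set_integrable lborel (cball c r) (\<lambda>u. t * f u)"
      by (intro set_integrable_compact continuous_intros cont) auto
    fix u
    show "f (c + t *\<^sub>R (u - c)) \<le> t * f u"
      using convex_onD[OF cvx, of t c u] t zero by (simp add: algebra_simps)
  qed
  finally show ?thesis using t by simp
qed

section \<open>Second differences\<close>

definition second_difference :: "('a::real_vector \<Rightarrow> real) \<Rightarrow> 'a \<Rightarrow> 'a \<Rightarrow> real" where
  "second_difference f m h = f (m + h) + f (m - h) - 2 * f m"

lemma second_difference_nonneg:
  assumes "convex_on UNIV f"
  shows "0 \<le> second_difference f m h"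
proof -
  have "m = (1/2) *\<^sub>R (m + h) + (1/2) *\<^sub>R (m - h)" 
    by (simp add: scaleR_add_right scaleR_diff_right flip: scaleR_left_distrib)
  then have "f m \<le> (1/2) * f (m + h) + (1/2) * f (m - h)"
    using convex_onD[OF assms, of "1/2" "m + h" "m - h"] by simp
  then show ?thesis by (simp add: second_difference_def)
qed

lemma continuous_on_second_difference:
  fixes f :: "'a::real_normed_vector \<Rightarrow> real"
  assumes "continuous_on UNIV f" "continuous_on S u" "continuous_on S v"
  shows "continuous_on S (\<lambda>p. second_difference f (u p) (v p))"
  unfolding second_difference_def
  by (intro continuous_intros continuous_on_compose2[OF assms(1)] assms(2,3)) auto

lemma power_diff_le:
  fixes s t :: real
  assumes "0 \<le> s" "0 \<le> t"
  shows "(s + t) ^ n - s ^ n \<le> real n * t * (s + t) ^ (n - 1)"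
proof (induction n)
  case (Suc n)
  show ?case
  proof (cases n)
    case 0 then show ?thesis by simp
  next
    case (Suc k)
    have "(s + t) ^ Suc n - s ^ Suc n = (s + t) * ((s + t) ^ n - s ^ n) + t * s ^ n"
      by (simp add: algebra_simps)
    also have "\<dots> \<le> (s + t) * (real n * t * (s + t) ^ (n - 1)) + t * (s + t) ^ n"
      using Suc.IH assms by (intro add_mono mult_left_mono power_mono) auto
    also have "\<dots> = real (Suc n) * t * (s + t) ^ (Suc n - 1)"
      using Suc by (simp add: algebra_simps)
    finally show ?thesis .
  qed
qed simp

text \<open>The integrals of \<open>F\<close> over the shifted and the unshifted ball differ only on their symmetric
  difference. Comparing \<open>K + F \<ge> 0\<close> on one ball and \<open>K - F \<ge> 0\<close> on the other with the concentric
  ball of radius \<open>R + norm h\<close>, which contains both, bounds this by the volume of a shell.\<close>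
lemma set_integral_cball_shift_le:
  fixes F :: "'a::euclidean_space \<Rightarrow> real"
  assumes cont: "continuous_on UNIV F" and bd: "\<And>x. \<bar>F x\<bar> \<le> K" and R: "0 \<le> R"
  shows "(LINT x:cball a R|lborel. F (x + h) - F x)
       \<le> 2 * K * (measure lborel (ball (0::'a) 1) * (real DIM('a) * norm h * (R + norm h) ^ (DIM('a) - 1)))"
proof -
  let ?I = "\<lambda>S f. LINT x:S|lborel. f x :: real"
  let ?B = "cball a R" and ?A = "cball (a + h) R" and ?C = "cball a (R + norm h)"
  have contp: "continuous_on UNIV (\<lambda>x. K + F x)" and contm: "continuous_on UNIV (\<lambda>x. K - F x)"
    and conth: "continuous_on UNIV (\<lambda>x. F (x + h))"
    by (auto intro!: continuous_intros cont continuous_on_compose2[OF cont])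
  have int: "set_integrable lborel (cball c r) g" if "continuous_on UNIV g" for c :: 'a and r and g :: "'a \<Rightarrow> real"
    using that by (intro set_integrable_compact) auto
  have constint: "set_integrable lborel (cball c r) (\<lambda>x. K)" for c :: 'a and r
    by (intro int) auto
  have nonneg: "0 \<le> K + F x" for x
    using bd[of x] by linarith
  have "?A \<subseteq> ?C"
  proof
    fix y assume "y \<in> ?A"
    then have "dist (a + h) y \<le> R" by simp
    moreover have "dist a y \<le> dist a (a + h) + dist (a + h) y" by (rule dist_triangle)
    moreover have "dist a (a + h) = norm h" by (simp add: dist_norm)
    ultimately show "y \<in> ?C" by simp
  qed
  then have "?I ?A (\<lambda>x. K + F x) \<le> ?I ?C (\<lambda>x. K + F x)"
    using bd by (intro set_integral_mono_domain int contp) (auto simp: nonneg)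
  moreover have "?I ?B (\<lambda>x. K - F x) \<le> ?I ?C (\<lambda>x. K - F x)"
    using bd by (intro set_integral_mono_domain int contm subset_cball) (auto simp: abs_le_iff)
  ultimately have "?I ?A F - ?I ?B F \<le> 2 * K * measure lborel ?C - K * measure lborel ?A - K * measure lborel ?B"
    using int[OF cont] constint by (simp add: set_integral_cball_const algebra_simps)
  also have "\<dots> = 2 * K * (measure lborel (ball (0::'a) 1) * ((R + norm h) ^ DIM('a) - R ^ DIM('a)))"
    using R by (simp add: measure_cball_eq algebra_simps)
  also have "\<dots> \<le> 2 * K * (measure lborel (ball (0::'a) 1) * (real DIM('a) * norm h * (R + norm h) ^ (DIM('a) - 1)))"
    using power_diff_le[OF R norm_ge_zero[of h]] bd[of 0] by (intro mult_left_mono) auto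
  finally have main: "?I ?A F - ?I ?B F \<le> 2 * K * (measure lborel (ball (0::'a) 1) * (real DIM('a) * norm h * (R + norm h) ^ (DIM('a) - 1)))" .
  have "?I ?A F = ?I ?B (\<lambda>x. F (x + h))"
    using set_integral_cball_affine[of 1 F "a + h" R a] cont
    by (simp add: borel_measurable_continuous_onI algebra_simps)
  with main show ?thesis using int[OF cont] int[OF conth] by simp
qed

text \<open>The second difference is a shift by \<open>h\<close> of the first difference \<open>\<lambda>x. f x - f (x - h)\<close>, minus
  that first difference. The Lipschitz constant therefore enters once, but \<open>b\<close> squared: one factor
  bounds the first difference, the other the thickness of the shell.\<close>
lemma set_integral_second_difference_le:
  fixes f :: "'a::euclidean_space \<Rightarrow> real"
  assumes L: "L-lipschitz_on UNIV f" and R: "0 \<le> R" and h: "norm h \<le> b"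
  shows "(LINT x:cball a R|lborel. second_difference f x h)
       \<le> 2 * L * b\<^sup>2 * real DIM('a) * measure lborel (ball (0::'a) 1) * (R + b) ^ (DIM('a) - 1)"
proof -
  define F where "F x = f x - f (x - h)" for x
  have cont: "continuous_on UNIV f" using L by (rule lipschitz_on_continuous_on)
  have contF: "continuous_on UNIV F"
    unfolding F_def by (intro continuous_intros continuous_on_compose2[OF cont]) auto
  have L0: "0 \<le> L" using L by (rule lipschitz_on_nonneg)
  have bd: "\<bar>F x\<bar> \<le> L * norm h" for x
    using lipschitz_onD[OF L, of x "x - h"] by (simp add: F_def dist_norm)
  have b: "0 \<le> b" using h norm_ge_zero order_trans by blast
  have "(LINT x:cball a R|lborel. second_difference f x h) = (LINT x:cball a R|lborel. F (x + h) - F x)"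
    by (simp add: F_def second_difference_def algebra_simps)
  also have "\<dots> \<le> 2 * (L * norm h) * (measure lborel (ball (0::'a) 1)
      * (real DIM('a) * norm h * (R + norm h) ^ (DIM('a) - 1)))"
    by (rule set_integral_cball_shift_le[OF contF bd R])
  also have "\<dots> \<le> 2 * (L * b) * (measure lborel (ball (0::'a) 1)
      * (real DIM('a) * b * (R + b) ^ (DIM('a) - 1)))"
    using h b L0 R by (intro mult_mono power_mono mult_nonneg_nonneg) auto
  finally show ?thesis by (simp add: power2_eq_square mult_ac)
qed


text \<open>For fixed \<open>h\<close>, Jensen's inequality replaces the integrals of \<open>f (m + h)\<close> and \<open>f (m - h)\<close> over
  \<open>m\<close> by the values at \<open>m = c\<close>. Integrating over \<open>h\<close> leaves twice the integral of \<open>f\<close> over the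
  large ball, minus twice that over the small one, each weighted with the volume of the other ball.
  The homothety of ratio \<open>1/4\<close> shows that the subtracted term is at most a quarter of the first,
  whence the factor \<open>2 * (1 - 1/4) = 3/2\<close>.\<close>
lemma set_integral_second_difference_ge:
  fixes f :: "'a::euclidean_space \<Rightarrow> real"
  assumes cvx: "convex_on UNIV f" and cont: "continuous_on UNIV f" and zero: "f c = 0" and a: "0 < a"
  shows "3 / 2 * measure lborel (cball (0::'a) a) * (LINT y:cball c (4 * a)|lborel. f y)
       \<le> (LINT h:cball 0 (4 * a)|lborel. LINT m:cball c a|lborel. second_difference f m h)"
proof -
  let ?V = "\<lambda>r. measure lborel (cball (0::'a) r)" and ?J = "\<lambda>r. LINT y:cball c r|lborel. f y"
  have int: "set_integrable lborel (cball b r) g" if "continuous_on UNIV g"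
    for b :: 'a and r and g :: "'a \<Rightarrow> real"
    using that by (intro set_integrable_compact) auto
  have shift: "continuous_on UNIV (\<lambda>m. f (m + h))" "continuous_on UNIV (\<lambda>m. f (m - h))"
       "continuous_on UNIV (\<lambda>h. f (c + h))" "continuous_on UNIV (\<lambda>h. f (c - h))" for h
    by (auto intro!: continuous_intros continuous_on_compose2[OF cont])
  have around: "(LINT h:cball 0 r|lborel. f (c + h)) = ?J r" 
               "(LINT h:cball 0 r|lborel. f (c - h)) = ?J r" for r
    using set_integral_cball_affine[of 1 f c r 0] set_integral_cball_affine[of "-1" f c r 0] cont
    by (simp_all add: borel_measurable_continuous_onI)
  have inner: "?V a * (f (c + h) + f (c - h)) - 2 * ?J a
      \<le> (LINT m:cball c a|lborel. second_difference f m h)" for h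
  proof -
    have "?V a * f (c + h) \<le> (LINT m:cball c a|lborel. f (m + h))"
      and "?V a * f (c - h) \<le> (LINT m:cball c a|lborel. f (m - h))"
      using convex_le_set_integral_cball[OF cvx cont, of "c + h" a]
        convex_le_set_integral_cball[OF cvx cont, of "c - h" a] a
        set_integral_cball_affine[of 1 f "c + h" a c] set_integral_cball_affine[of 1 f "c - h" a c] cont
      by (simp_all add: borel_measurable_continuous_onI measure_cball_eq algebra_simps)
    moreover have "(LINT m:cball c a|lborel. second_difference f m h)
        = (LINT m:cball c a|lborel. f (m + h)) + (LINT m:cball c a|lborel. f (m - h)) - 2 * ?J a"
      unfolding second_difference_def using int[OF shift(1)] int[OF shift(2)] int[OF cont]
      by (subst set_integral_diff) auto
    ultimately show ?thesis by (simp add: algebra_simps)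
  qed
  have "?J a \<le> (1/4) ^ DIM('a) * (1/4 * ?J (4 * a))"
    using set_integral_cball_homothety_le[OF cvx cont zero, of "1/4" "4 * a"] by simp
  then have "?V (4 * a) * ?J a \<le> ?V (4 * a) * ((1/4) ^ DIM('a) * (1/4 * ?J (4 * a)))"
    by (intro mult_left_mono) auto
  also have "\<dots> = 1/4 * ?V a * ?J (4 * a)"
    using a by (simp add: measure_cball_eq power_mult_distrib power_one_over)
  finally have "3 / 2 * ?V a * ?J (4 * a) \<le> 2 * ?V a * ?J (4 * a) - ?V (4 * a) * (2 * ?J a)"
    by simp
  also have "\<dots> = (LINT h:cball 0 (4 * a)|lborel. ?V a * (f (c + h) + f (c - h)) - 2 * ?J a)"
    using int[OF shift(3)] int[OF shift(4)] int[OF continuous_on_const]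
    by (subst set_integral_diff) (auto simp: around set_integral_cball_const)
  also have "\<dots> \<le> (LINT h:cball 0 (4 * a)|lborel. LINT m:cball c a|lborel. second_difference f m h)"
  proof (rule set_integral_mono)
    show "set_integrable lborel (cball 0 (4 * a)) (\<lambda>h. ?V a * (f (c + h) + f (c - h)) - 2 * ?J a)"
      by (intro int continuous_intros shift)
    show "set_integrable lborel (cball 0 (4 * a)) (\<lambda>h. LINT m:cball c a|lborel. second_difference f m h)"
      by (intro set_integrable_section_integral)
         (auto simp: case_prod_beta intro!: continuous_on_second_difference cont continuous_intros)
  qed (rule inner)
  finally show ?thesis .
qed

section \<open>Oscillation of the subgradients\<close>

lemma convex_on_diff_affine:
  fixes f :: "'a::real_inner \<Rightarrow> real"
  assumes cvx: "convex_on UNIV f"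
  shows "convex_on UNIV (\<lambda>y. f y - k - g \<bullet> (y - x))"
proof (rule convex_onI)
  fix t :: real and u v :: 'a
  assume t: "0 < t" "t < 1"
  have "f ((1 - t) *\<^sub>R u + t *\<^sub>R v) \<le> (1 - t) * f u + t * f v"
    using convex_onD[OF cvx, of t u v] t by simp
  then show "f ((1 - t) *\<^sub>R u + t *\<^sub>R v) - k - g \<bullet> ((1 - t) *\<^sub>R u + t *\<^sub>R v - x)
      \<le> (1 - t) * (f u - k - g \<bullet> (u - x)) + t * (f v - k - g \<bullet> (v - x))"
    by (simp add: inner_diff_right inner_add_right algebra_simps)
qed simp

text \<open>Let \<open>e\<close> be the direction of \<open>g2 - g1\<close>. The integrand \<open>\<psi>\<close> is at least the affine function
  \<open>(g2 - g1) \<bullet> (y - x2)\<close>. Going \<open>3\<eta>\<close> from \<open>x1\<close> along \<open>e\<close> overcomes the distance \<open>2\<eta>\<close> to \<open>x2\<close>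
  and leaves the value \<open>\<eta> * norm (g2 - g1)\<close>, and a ball of radius \<open>\<eta>\<close> about the point \<open>p\<close>
  so reached still fits into the ball of radius \<open>4\<eta>\<close> about \<open>x1\<close>; Jensen's inequality on that
  smaller ball and \<open>\<psi> \<ge> 0\<close> elsewhere conclude.\<close>
lemma subgradient_gap_le_set_integral:
  fixes \<phi> :: "'a::euclidean_space \<Rightarrow> real"
  assumes cvx: "convex_on UNIV \<phi>" and cont: "continuous_on UNIV \<phi>" and \<eta>: "0 < \<eta>"
    and close: "dist x1 x2 \<le> 2 * \<eta>"
    and g: "g1 \<in> subdifferential \<phi> x1" "g2 \<in> subdifferential \<phi> x2"
  shows "measure lborel (cball (0::'a) \<eta>) * (\<eta> * norm (g2 - g1))
       \<le> (LINT y:cball x1 (4 * \<eta>)|lborel. \<phi> y - \<phi> x1 - g1 \<bullet> (y - x1))"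
proof -
  define \<psi> where "\<psi> y = \<phi> y - \<phi> x1 - g1 \<bullet> (y - x1)" for y
  define e where "e = (g2 - g1) /\<^sub>R norm (g2 - g1)"
  define p where "p = x1 + (3 * \<eta>) *\<^sub>R e"
  have ne: "norm e \<le> 1" and ge: "(g2 - g1) \<bullet> e = norm (g2 - g1)"
    by (cases "g2 = g1"; simp add: e_def power2_norm_eq_inner[symmetric] power2_eq_square)+
  have sub1: "\<phi> y \<ge> \<phi> x1 + g1 \<bullet> (y - x1)" and sub2: "\<phi> y \<ge> \<phi> x2 + g2 \<bullet> (y - x2)" for y
    using g by (auto simp: subdifferential_def)
  have cont\<psi>: "continuous_on UNIV \<psi>"
    unfolding \<psi>_def by (intro continuous_intros cont)
  have cvx\<psi>: "convex_on UNIV \<psi>"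
    unfolding \<psi>_def by (rule convex_on_diff_affine[OF cvx])
  have "(g2 - g1) \<bullet> (x2 - x1) \<le> norm (g2 - g1) * norm (x2 - x1)"
    by (rule norm_cauchy_schwarz)
  also have "\<dots> \<le> norm (g2 - g1) * (2 * \<eta>)"
    using close by (intro mult_left_mono) (auto simp: dist_norm norm_minus_commute)
  finally have "\<eta> * norm (g2 - g1) \<le> (g2 - g1) \<bullet> (p - x2)"
    using ge by (simp add: p_def inner_diff_right inner_add_right algebra_simps)
  also have "\<dots> \<le> \<psi> p"
    using sub1[of x2] sub2[of p] by (simp add: \<psi>_def inner_diff_right inner_diff_left)
  finally have "measure lborel (cball (0::'a) \<eta>) * (\<eta> * norm (g2 - g1)) \<le> measure lborel (cball p \<eta>) * \<psi> p"
    using \<eta> by (simp add: measure_cball_eq mult_left_mono)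
  also have "\<dots> \<le> (LINT y:cball p \<eta>|lborel. \<psi> y)"
    by (rule convex_le_set_integral_cball[OF cvx\<psi> cont\<psi>])
  also have "\<dots> \<le> (LINT y:cball x1 (4 * \<eta>)|lborel. \<psi> y)"
  proof (rule set_integral_mono_domain)
    show "set_integrable lborel (cball x1 (4 * \<eta>)) \<psi>"
      by (intro set_integrable_compact cont\<psi>) auto
    show "cball p \<eta> \<subseteq> cball x1 (4 * \<eta>)"
    proof
      fix y assume "y \<in> cball p \<eta>"
      moreover have "dist x1 p \<le> 3 * \<eta>"
        using ne \<eta> by (simp add: p_def dist_norm)
      moreover have "dist x1 y \<le> dist x1 p + dist p y" by (rule dist_triangle)
      ultimately show "y \<in> cball x1 (4 * \<eta>)" by simp
    qed
    show "0 \<le> \<psi> y" for y using sub1[of y] by (simp add: \<psi>_def)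
  qed simp
  finally show ?thesis by (simp add: \<psi>_def)
qed

text \<open>The right-hand side depends on \<open>x\<close> only, which is the point: it bounds the gap of all pairs of
  subgradients at once, hence the diameter. Since second differences are nonnegative, enlarging the
  ball of radius \<open>\<eta>\<close> about \<open>x1\<close> to the ball of radius \<open>2\<eta>\<close> about \<open>x\<close> only increases the
  integral.\<close>
lemma subgradient_gap_le_second_differences:
  fixes \<phi> :: "'a::euclidean_space \<Rightarrow> real"
  assumes cvx: "convex_on UNIV \<phi>" and cont: "continuous_on UNIV \<phi>" and \<eta>: "0 < \<eta>"
    and x: "x1 \<in> ball x \<eta>" "x2 \<in> ball x \<eta>"
    and g: "g1 \<in> subdifferential \<phi> x1" "g2 \<in> subdifferential \<phi> x2"
  shows "3 / 2 * \<eta> * (measure lborel (cball (0::'a) \<eta>))\<^sup>2 * norm (g2 - g1)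
       \<le> (LINT h:cball 0 (4 * \<eta>)|lborel. LINT z:cball 0 (2 * \<eta>)|lborel. second_difference \<phi> (x + z) h)"
proof -
  let ?V = "measure lborel (cball (0::'a) \<eta>)"
  define \<psi> where "\<psi> y = \<phi> y - \<phi> x1 - g1 \<bullet> (y - x1)" for y
  have cont\<psi>: "continuous_on UNIV \<psi>"
    unfolding \<psi>_def by (intro continuous_intros cont)
  have cvx\<psi>: "convex_on UNIV \<psi>"
    unfolding \<psi>_def by (rule convex_on_diff_affine[OF cvx])
  have same: "second_difference \<psi> m h = second_difference \<phi> m h" for m h
    by (simp add: second_difference_def \<psi>_def inner_diff_right inner_add_right)
  have int: "set_integrable lborel (cball 0 (4 * \<eta>)) (\<lambda>h. LINT m:cball c r|lborel. second_difference \<phi> m h)"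
    for c :: 'a and r
    by (intro set_integrable_section_integral)
       (auto simp: case_prod_beta intro!: continuous_on_second_difference cont continuous_intros)
  have "dist x1 x2 \<le> dist x1 x + dist x x2" by (rule dist_triangle)
  then have "dist x1 x2 \<le> 2 * \<eta>" using x by (simp add: dist_commute)
  then have "?V * (\<eta> * norm (g2 - g1)) \<le> (LINT y:cball x1 (4 * \<eta>)|lborel. \<psi> y)"
    using subgradient_gap_le_set_integral[OF cvx cont \<eta> _ g] by (simp add: \<psi>_def)
  then have "3 / 2 * ?V * (?V * (\<eta> * norm (g2 - g1))) \<le> 3 / 2 * ?V * (LINT y:cball x1 (4 * \<eta>)|lborel. \<psi> y)"
    by (intro mult_left_mono) auto
  also have "\<dots> \<le> (LINT h:cball 0 (4 * \<eta>)|lborel. LINT m:cball x1 \<eta>|lborel. second_difference \<phi> m h)"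
    using set_integral_second_difference_ge[OF cvx\<psi> cont\<psi> _ \<eta>, of x1] by (simp add: same \<psi>_def[of x1])
  also have "\<dots> \<le> (LINT h:cball 0 (4 * \<eta>)|lborel. LINT m:cball x (2 * \<eta>)|lborel. second_difference \<phi> m h)"
  proof (rule set_integral_mono[OF int int], rule set_integral_mono_domain)
    show "set_integrable lborel (cball x (2 * \<eta>)) (\<lambda>m. second_difference \<phi> m h)" for h
      by (intro set_integrable_compact continuous_on_second_difference cont continuous_intros) auto
    show "cball x1 \<eta> \<subseteq> cball x (2 * \<eta>)"
    proof
      fix y assume "y \<in> cball x1 \<eta>"
      then show "y \<in> cball x (2 * \<eta>)" using x dist_triangle[of x y x1] by simp
    qed
  qed (auto intro: second_difference_nonneg[OF cvx])
  also have "\<dots> = (LINT h:cball 0 (4 * \<eta>)|lborel. LINT z:cball 0 (2 * \<eta>)|lborel. second_difference \<phi> (x + z) h)"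
  proof -
    have "(LINT m:cball x (2 * \<eta>)|lborel. second_difference \<phi> m h)
        = (LINT z:cball 0 (2 * \<eta>)|lborel. second_difference \<phi> (x + z) h)" for h
      using set_integral_cball_affine[of 1 "\<lambda>m. second_difference \<phi> m h" x "2 * \<eta>" 0]
      by (simp add: borel_measurable_continuous_onI continuous_on_second_difference cont)
    then show ?thesis by simp
  qed
  finally show ?thesis by (simp add: power2_eq_square mult_ac)
qed

section \<open>The diameter of the subdifferential of a ball\<close>

text \<open>Test the subgradient inequality at the point \<open>x + g\<close>.\<close>
lemma subdifferential_norm_le:
  fixes \<phi> :: "'a::real_inner \<Rightarrow> real"
  assumes L: "L-lipschitz_on UNIV \<phi>" and g: "g \<in> subdifferential \<phi> x"
  shows "norm g \<le> L"
proof (cases "g = 0")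
  case True
  then show ?thesis using lipschitz_on_nonneg[OF L] by simp
next
  case False
  have "\<phi> x + g \<bullet> ((x + g) - x) \<le> \<phi> (x + g)"
    using g unfolding subdifferential_def by blast
  moreover have "\<bar>\<phi> (x + g) - \<phi> x\<bar> \<le> L * norm g"
    using lipschitz_onD[OF L, of "x + g" x] by (simp add: dist_norm)
  ultimately have "norm g * norm g \<le> L * norm g"
    by (simp add: power2_norm_eq_inner[symmetric] power2_eq_square)
  then show ?thesis using False by simp
qed

lemma diameter_subdifferential_on_bounds:
  fixes \<phi> :: "'a::real_inner \<Rightarrow> real"
  assumes L: "L-lipschitz_on UNIV \<phi>"
  shows bounded_subdifferential_on: "bounded (subdifferential_on \<phi> A)"
    and "0 \<le> diameter (subdifferential_on \<phi> A)"
    and "diameter (subdifferential_on \<phi> A) \<le> 2 * L"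
proof -
  have le: "norm g \<le> L" if "g \<in> subdifferential_on \<phi> A" for g
    using that subdifferential_norm_le[OF L] by (auto simp: subdifferential_on_def)
  then show b: "bounded (subdifferential_on \<phi> A)" by (auto simp: bounded_iff)
  then show "0 \<le> diameter (subdifferential_on \<phi> A)" by (rule diameter_ge_0)
  show "diameter (subdifferential_on \<phi> A) \<le> 2 * L"
  proof (rule diameter_le)
    fix u v assume "u \<in> subdifferential_on \<phi> A" "v \<in> subdifferential_on \<phi> A"
    then show "norm (u - v) \<le> 2 * L" using le[of u] le[of v] norm_triangle_ineq4[of u v] by linarith
  qed (use lipschitz_on_nonneg[OF L] in simp)
qed

text \<open>The function is lower semicontinuous, because the ball is open: two subgradients at distance
  above \<open>a\<close>, taken at points \<open>y\<close> and \<open>z\<close> of the ball about \<open>x\<close>, still compete for every centre in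
  the neighbourhood \<open>ball y \<eta> \<inter> ball z \<eta>\<close> of \<open>x\<close>.\<close>
lemma borel_measurable_diameter_subdifferential_on:
  fixes \<phi> :: "'a::real_inner \<Rightarrow> real"
  assumes L: "L-lipschitz_on UNIV \<phi>"
  shows "(\<lambda>x. diameter (subdifferential_on \<phi> (ball x \<eta>))) \<in> borel_measurable borel"
proof -
  let ?d = "\<lambda>x. diameter (subdifferential_on \<phi> (ball x \<eta>))"
  have "open {x. a < ?d x}" for a
  proof (subst open_subopen, safe)
    fix x assume a: "a < ?d x"
    show "\<exists>T. open T \<and> x \<in> T \<and> T \<subseteq> {x. a < ?d x}"
      \<comment> \<open>For negative \<open>a\<close> there may be no pair of subgradients: \<open>diameter\<close> of the empty set is \<open>0\<close>.\<close>
    proof (cases "a < 0")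
      case True
      then have "{x. a < ?d x} = UNIV"
        using diameter_subdifferential_on_bounds(2)[OF L] by (auto intro: less_le_trans)
      then show ?thesis by auto
    next
      case False
      obtain u v where uv: "u \<in> subdifferential_on \<phi> (ball x \<eta>)" "v \<in> subdifferential_on \<phi> (ball x \<eta>)" "a < norm (u - v)"
        using diameter_le[of "subdifferential_on \<phi> (ball x \<eta>)" a] False a by force
      then obtain y z where yz: "y \<in> ball x \<eta>" "u \<in> subdifferential \<phi> y" "z \<in> ball x \<eta>" "v \<in> subdifferential \<phi> z"
        by (auto simp: subdifferential_on_def)
      have "ball y \<eta> \<inter> ball z \<eta> \<subseteq> {x. a < ?d x}"
      proof
        fix w assume "w \<in> ball y \<eta> \<inter> ball z \<eta>"
        then have "u \<in> subdifferential_on \<phi> (ball w \<eta>)" "v \<in> subdifferential_on \<phi> (ball w \<eta>)"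
          using yz by (auto simp: subdifferential_on_def dist_commute)
        then have "dist u v \<le> ?d w"
          by (rule diameter_bounded_bound[OF bounded_subdifferential_on[OF L]])
        with uv show "w \<in> {x. a < ?d x}" by (simp add: dist_norm)
      qed
      then show ?thesis
        using yz by (intro exI[of _ "ball y \<eta> \<inter> ball z \<eta>"]) (auto simp: dist_commute)
    qed
  qed
  then show ?thesis
    by (subst borel_measurable_iff_greater) auto
qed

text \<open>The estimate for the first power. The lower bound for \<open>Q\<close> holds at each \<open>x\<close>; in the integral of
  \<open>Q\<close> over \<open>x\<close>, the integration over \<open>x\<close> is carried out first, where the shell estimate gives a
  bound \<open>C\<close> that is uniform in the shift \<open>z\<close> and the step \<open>h\<close>. To exchange the order in one
  step, \<open>h\<close> and \<open>z\<close> are taken together as one variable in the product space.\<close>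
lemma set_integral_diameter_subdifferential_on_le:
  fixes \<phi> :: "'a::euclidean_space \<Rightarrow> real"
  assumes cvx: "convex_on UNIV \<phi>" and L: "L-lipschitz_on UNIV \<phi>" and \<eta>: "0 < \<eta>" and R: "0 \<le> R"
  shows "set_integrable lborel (cball 0 R) (\<lambda>x. diameter (subdifferential_on \<phi> (ball x \<eta>)))"
    and "(LINT x:cball 0 R|lborel. diameter (subdifferential_on \<phi> (ball x \<eta>)))
       \<le> 64 / 3 * 8 ^ DIM('a) * real DIM('a) * measure lborel (ball (0::'a) 1) * (R + 4 * \<eta>) ^ (DIM('a) - 1) * L * \<eta>"
proof -
  let ?d = "\<lambda>x. diameter (subdifferential_on \<phi> (ball x \<eta>))"
  let ?V = "measure lborel (cball (0::'a) \<eta>)"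
  let ?S = "cball (0::'a) (4 * \<eta>)" and ?T = "cball (0::'a) (2 * \<eta>)"
  define Q where "Q x = (LINT p:?S \<times> ?T|lborel. second_difference \<phi> (x + snd p) (fst p))" for x
  define C where "C = 2 * L * (4 * \<eta>)\<^sup>2 * real DIM('a) * measure lborel (ball (0::'a) 1) * (R + 4 * \<eta>) ^ (DIM('a) - 1)"
  have cont: "continuous_on UNIV \<phi>" using L by (rule lipschitz_on_continuous_on)
  have V: "0 < ?V" using \<eta> content_cball_pos by blast
  have [measurable]: "?d \<in> borel_measurable borel"
    by (rule borel_measurable_diameter_subdifferential_on[OF L])
  show int: "set_integrable lborel (cball 0 R) ?d"
    unfolding set_integrable_def
  proof (rule Bochner_Integration.integrable_bound)
    show "integrable lborel (\<lambda>x. indicator (cball (0::'a) R) x *\<^sub>R (2 * L))"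
      using set_integrable_compact[of "cball (0::'a) R" "\<lambda>_. 2 * L"] by (simp add: set_integrable_def)
    have "norm (?d x) \<le> norm (2 * L)" for x
      using diameter_subdifferential_on_bounds(2,3)[OF L, of "ball x \<eta>"] by simp
    then show "AE x in lborel. norm (indicator (cball 0 R) x *\<^sub>R ?d x)
        \<le> norm (indicator (cball (0::'a) R) x *\<^sub>R (2 * L))"
      by (intro AE_I2) (simp add: indicator_def)
    show "(\<lambda>x. indicator (cball (0::'a) R) x *\<^sub>R ?d x) \<in> borel_measurable lborel"
      by (intro borel_measurable_scaleR borel_measurable_indicator) auto
  qed
  have contD: "continuous_on UNIV (\<lambda>(x, p). second_difference \<phi> (x + snd p) (fst p))"
    by (auto simp: case_prod_beta intro!: continuous_on_second_difference cont continuous_intros)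
  have ST: "compact (?S \<times> ?T)" by (intro compact_Times) auto
  have intQ: "set_integrable lborel (cball 0 R) Q"
    unfolding Q_def by (intro set_integrable_section_integral ST contD) auto
  have Q: "Q x = (LINT h:?S|lborel. LINT z:?T|lborel. second_difference \<phi> (x + z) h)" for x
    unfolding Q_def
    by (intro set_integral_product)
       (auto simp: case_prod_beta intro!: continuous_on_second_difference cont continuous_intros)
  have lower: "3 / 2 * \<eta> * ?V\<^sup>2 * ?d x \<le> Q x" for x
  proof -
    have K: "0 < 3 / 2 * \<eta> * ?V\<^sup>2" using V \<eta> by simp
    have Q0: "0 \<le> Q x"
      unfolding Q_def set_lebesgue_integral_def
      by (intro integral_nonneg_AE) (auto simp: second_difference_nonneg[OF cvx])
    have "?d x \<le> Q x / (3 / 2 * \<eta> * ?V\<^sup>2)"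
    proof (rule diameter_le)
      show "subdifferential_on \<phi> (ball x \<eta>) \<noteq> {} \<or> 0 \<le> Q x / (3 / 2 * \<eta> * ?V\<^sup>2)"
        using Q0 K by simp
      fix u v assume "u \<in> subdifferential_on \<phi> (ball x \<eta>)" "v \<in> subdifferential_on \<phi> (ball x \<eta>)"
      then have "3 / 2 * \<eta> * ?V\<^sup>2 * norm (u - v) \<le> Q x"
        using subgradient_gap_le_second_differences[OF cvx cont \<eta>]
        by (auto simp: subdifferential_on_def Q)
      then show "norm (u - v) \<le> Q x / (3 / 2 * \<eta> * ?V\<^sup>2)"
        using K by (simp add: pos_le_divide_eq mult.commute)
    qed
    then show ?thesis using K by (simp add: pos_le_divide_eq mult.commute)
  qed
  have upper: "(LINT x:cball 0 R|lborel. second_difference \<phi> (x + snd p) (fst p)) \<le> C" if "p \<in> ?S \<times> ?T" for p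
  proof -
    have "(LINT x:cball 0 R|lborel. second_difference \<phi> (x + snd p) (fst p))
        = (LINT x:cball (snd p) R|lborel. second_difference \<phi> x (fst p))"
      using set_integral_cball_affine[of 1 "\<lambda>m. second_difference \<phi> m (fst p)" "snd p" R 0]
      by (simp add: borel_measurable_continuous_onI continuous_on_second_difference cont add.commute)
    also have "\<dots> \<le> C"
      unfolding C_def using that by (intro set_integral_second_difference_le[OF L R]) auto
    finally show ?thesis .
  qed
  have "3 / 2 * \<eta> * ?V\<^sup>2 * (LINT x:cball 0 R|lborel. ?d x) = (LINT x:cball 0 R|lborel. 3 / 2 * \<eta> * ?V\<^sup>2 * ?d x)"
    by simp
  also have "\<dots> \<le> (LINT x:cball 0 R|lborel. Q x)"
    using int intQ lower by (intro set_integral_mono) auto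
  also have "\<dots> = (LINT p:?S \<times> ?T|lborel. LINT x:cball 0 R|lborel. second_difference \<phi> (x + snd p) (fst p))"
    unfolding Q_def by (intro set_integral_swap ST contD) auto
  also have "\<dots> \<le> (LINT p:?S \<times> ?T|lborel. C)"
  proof (rule set_integral_mono)
    show "set_integrable lborel (?S \<times> ?T) (\<lambda>p. LINT x:cball 0 R|lborel. second_difference \<phi> (x + snd p) (fst p))"
      by (intro set_integrable_section_integral ST)
         (auto simp: case_prod_beta intro!: continuous_on_second_difference cont continuous_intros)
    show "set_integrable lborel (?S \<times> ?T) (\<lambda>p. C)"
      by (intro set_integrable_compact ST) auto
  qed (rule upper)
  also have "\<dots> = (LINT h:?S|lborel. LINT z:?T|lborel. C)"
    by (intro set_integral_product) (auto simp: case_prod_beta)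
  also have "\<dots> = measure lborel ?S * (measure lborel ?T * C)"
    by (simp add: set_integral_cball_const)
  also have "\<dots> = ?V\<^sup>2 * (8 ^ DIM('a) * C)"
  proof -
    have "(8::real) ^ DIM('a) = 4 ^ DIM('a) * 2 ^ DIM('a)" by (simp flip: power_mult_distrib)
    then show ?thesis using \<eta> by (simp add: measure_cball_eq power_mult_distrib power2_eq_square)
  qed
  finally have "?V\<^sup>2 * (3 / 2 * \<eta> * (LINT x:cball 0 R|lborel. ?d x)) \<le> ?V\<^sup>2 * (8 ^ DIM('a) * C)"
    by (simp add: mult_ac)
  then have "3 / 2 * \<eta> * (LINT x:cball 0 R|lborel. ?d x) \<le> 8 ^ DIM('a) * C"
    using V by simp
  also have "\<dots> = 3 / 2 * \<eta> * (64 / 3 * 8 ^ DIM('a) * real DIM('a) * measure lborel (ball (0::'a) 1)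
      * (R + 4 * \<eta>) ^ (DIM('a) - 1) * L * \<eta>)"
    by (simp add: C_def power2_eq_square)
  finally show "(LINT x:cball 0 R|lborel. ?d x) \<le> 64 / 3 * 8 ^ DIM('a) * real DIM('a)
      * measure lborel (ball (0::'a) 1) * (R + 4 * \<eta>) ^ (DIM('a) - 1) * L * \<eta>"
    using \<eta> by (simp add: mult_ac)
qed

section \<open>The smallest Lipschitz constant and the q-th power\<close>

text \<open>The infimum is attained, since the inequalities that define a Lipschitz constant are
  closed conditions on it.\<close>
lemma Lip_lipschitz_on:
  fixes f :: "'a::metric_space \<Rightarrow> 'b::metric_space"
  assumes "\<exists>L. L-lipschitz_on UNIV f"
  shows "(Lip f)-lipschitz_on UNIV f"
proof (rule lipschitz_onI)
  let ?A = "{L. L-lipschitz_on UNIV f}"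
  have ne: "?A \<noteq> {}" using assms by auto
  show "0 \<le> Lip f"
    unfolding Lip_def using ne by (intro cInf_greatest) (auto dest: lipschitz_on_nonneg)
  fix x y
  show "dist (f x) (f y) \<le> Lip f * dist x y"
  proof (cases "x = y")
    case False
    have "dist (f x) (f y) / dist x y \<le> Lip f"
      unfolding Lip_def using ne False
      by (intro cInf_greatest) (auto simp: divide_le_eq dest: lipschitz_onD)
    then show ?thesis using False by (simp add: divide_le_eq)
  qed simp
qed

theorem corollary2p2:
  fixes \<phi> :: "real ^ 'n \<Rightarrow> real" and \<eta> R q :: real
  assumes "convex_on UNIV \<phi>"
    and "\<exists>L. L-lipschitz_on UNIV \<phi>"
    and "\<eta> > 0" and "R > 0" and "q > 1"
  defines "d \<equiv> CARD('n)"
    and "\<beta> \<equiv> measure lborel (ball (0 :: real ^ 'n) 1)"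
  defines "c \<equiv> 48 * real d ^ 2 * \<beta> * 2 powr (3 * real d + q - 1) * (q / (q - 1))
                 * (R + 4 * \<eta>) ^ (d - 1)"
  shows "set_integrable lborel (ball 0 R)
           (\<lambda>x. diameter (subdifferential_on \<phi> (ball x \<eta>)) powr q)
       \<and> (LINT x:ball 0 R|lborel. diameter (subdifferential_on \<phi> (ball x \<eta>)) powr q)
           \<le> c * Lip \<phi> powr q * \<eta>"
proof -
  let ?d = "\<lambda>x. diameter (subdifferential_on \<phi> (ball x \<eta>))"
  let ?L = "Lip \<phi>"
  have L: "?L-lipschitz_on UNIV \<phi>" using assms(2) by (rule Lip_lipschitz_on)
  then have L0: "0 \<le> ?L" by (rule lipschitz_on_nonneg)
  note bounds = diameter_subdifferential_on_bounds(2,3)[OF L]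
  have [measurable]: "?d \<in> borel_measurable borel"
    by (rule borel_measurable_diameter_subdifferential_on[OF L])
  have L1: "set_integrable lborel (cball 0 R) ?d"
    "(LINT x:cball 0 R|lborel. ?d x) \<le> 64 / 3 * 8 ^ d * real d * \<beta> * (R + 4 * \<eta>) ^ (d - 1) * ?L * \<eta>"
    using set_integral_diameter_subdifferential_on_le[OF assms(1) L \<open>\<eta> > 0\<close>, of R] \<open>R > 0\<close>
    by (simp_all add: d_def \<beta>_def)
  have powr_le: "?d x powr q \<le> (2 * ?L) powr (q - 1) * ?d x" for x
  proof -
    have "?d x powr q = ?d x powr (q - 1) * ?d x"
      using powr_add[of "?d x" "q - 1" 1] bounds(1)[of "ball x \<eta>"] by simp
    also have "\<dots> \<le> (2 * ?L) powr (q - 1) * ?d x"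
      using bounds \<open>q > 1\<close> by (intro mult_right_mono powr_mono2) auto
    finally show ?thesis .
  qed
  have int: "set_integrable lborel (cball 0 R) (\<lambda>x. (2 * ?L) powr (q - 1) * ?d x)"
    using L1(1) by simp
  have intq: "set_integrable lborel (cball 0 R) (\<lambda>x. ?d x powr q)"
    unfolding set_integrable_def
  proof (rule Bochner_Integration.integrable_bound)
    show "integrable lborel (\<lambda>x. indicator (cball 0 R) x *\<^sub>R ((2 * ?L) powr (q - 1) * ?d x))"
      using int by (simp add: set_integrable_def)
    show "(\<lambda>x. indicator (cball 0 R) x *\<^sub>R (?d x powr q)) \<in> borel_measurable lborel"
      by (intro borel_measurable_scaleR borel_measurable_indicator) auto
    show "AE x in lborel. norm (indicator (cball 0 R) x *\<^sub>R (?d x powr q))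
        \<le> norm (indicator (cball 0 R) x *\<^sub>R ((2 * ?L) powr (q - 1) * ?d x))"
      using powr_le bounds by (intro AE_I2) (simp add: indicator_def abs_mult)
  qed
  have \<beta>0: "0 \<le> \<beta>" by (simp add: \<beta>_def)
  have d1: "1 \<le> real d" by (simp add: d_def)
  have "(LINT x:ball 0 R|lborel. ?d x powr q) \<le> (LINT x:cball 0 R|lborel. ?d x powr q)"
    using intq by (intro set_integral_mono_domain) auto
  also have "\<dots> \<le> (LINT x:cball 0 R|lborel. (2 * ?L) powr (q - 1) * ?d x)"
    by (rule set_integral_mono[OF intq int powr_le])
  also have "\<dots> \<le> (2 * ?L) powr (q - 1) * (64 / 3 * 8 ^ d * real d * \<beta> * (R + 4 * \<eta>) ^ (d - 1) * ?L * \<eta>)"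
    using mult_left_mono[OF L1(2), of "(2 * ?L) powr (q - 1)"]
    by (simp only: set_integral_mult_right powr_ge_zero)
  also have "\<dots> = (64 / 3 * real d * 1) * (\<beta> * 2 powr (3 * real d + q - 1) * (R + 4 * \<eta>) ^ (d - 1) * ?L powr q * \<eta>)"
  proof -
    have "(2 * ?L) powr (q - 1) * ?L = 2 powr (q - 1) * ?L powr q"
      using powr_add[of ?L "q - 1" 1] L0 by (simp add: powr_mult)
    moreover have "(2::real) powr (3 * real d + q - 1) = 8 ^ d * 2 powr (q - 1)"
    proof -
      have "(2::real) powr (3 * real d + q - 1) = 2 powr (real (3 * d)) * 2 powr (q - 1)"
        by (simp add: powr_add[symmetric] algebra_simps)
      also have "(2::real) powr (real (3 * d)) = 8 ^ d"
        by (subst powr_realpow) (simp_all add: power_mult)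
      finally show ?thesis .
    qed
    ultimately show ?thesis by (simp add: mult_ac)
  qed
  also have "\<dots> \<le> (48 * real d ^ 2 * (q / (q - 1))) * (\<beta> * 2 powr (3 * real d + q - 1) * (R + 4 * \<eta>) ^ (d - 1) * ?L powr q * \<eta>)"
  proof (rule mult_right_mono)
    have "64 / 3 * real d \<le> 48 * real d ^ 2"
      using d1 mult_mono[of 1 "real d" "real d" "real d"] by (simp add: power2_eq_square)
    then show "64 / 3 * real d * 1 \<le> 48 * real d ^ 2 * (q / (q - 1))"
      by (rule mult_mono) (use \<open>q > 1\<close> in auto)
    show "0 \<le> \<beta> * 2 powr (3 * real d + q - 1) * (R + 4 * \<eta>) ^ (d - 1) * ?L powr q * \<eta>"
      using \<beta>0 \<open>R > 0\<close> \<open>\<eta> > 0\<close> by (intro mult_nonneg_nonneg) auto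
  qed
  also have "\<dots> = c * ?L powr q * \<eta>" by (simp add: c_def mult_ac)
  finally have "(LINT x:ball 0 R|lborel. ?d x powr q) \<le> c * ?L powr q * \<eta>" .
  moreover have "set_integrable lborel (ball 0 R) (\<lambda>x. ?d x powr q)"
    using intq by (rule set_integrable_subset) auto
  ultimately show ?thesis by blast
qed

end
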